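(* Let $\ell\geq 2$ and $\gamma\geq 1$ be integers. There exists a family of $\ell$ pairwise non-cospectral unicyclic graphs, each on $n=2\ell^2+2\ell+2\gamma$ vertices, all having the same Laplacian energy. Moreover, for each $\gamma\geq 2$ there are at least two distinct such families.
   Context: A unicyclic graph is a connected graph containing exactly one cycle. Cospectrality refers to the Laplacian spectrum (multiset of eigenvalues of $L=D-A$, with $D$ the diagonal degree matrix and $A$ the adjacency matrix). For a graph on $n$ vertices with Laplacian eigenvalues $\mu_1,\ldots,\mu_n$ and average degree $\overline{d}$, the Laplacian energy is $LE(G)=\sum_{i=1}^n|\mu_i-\overline{d}|$. *)

theory Defs
  imports "Jordan_Normal_Form.Char_Poly" "Jordan_Normal_Form.Conjugate"
begin

text \<open>
  A finite simple graph is given by its number \<open>n\<close> of vertices and its edge set \<open>E\<close>; the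
  vertices are the numbers below \<open>n\<close> and the edges are two-element sets of vertices.
\<close>

definition simple_graph :: "nat \<Rightarrow> nat set set \<Rightarrow> bool" where
  "simple_graph n E \<longleftrightarrow> (\<forall>e\<in>E. e \<subseteq> {..<n} \<and> card e = 2)"

definition connected_graph :: "nat \<Rightarrow> nat set set \<Rightarrow> bool" where
  "connected_graph n E \<longleftrightarrow>
     n > 0 \<and> (\<forall>u<n. \<forall>v<n. (u, v) \<in> {(x, y). {x, y} \<in> E}\<^sup>*)"

text \<open>
  A cycle of a graph is a subgraph, identified with its edge set \<open>C\<close>. Hence rotations and
  reflections of the vertex sequence \<open>vs\<close> yield the same cycle.
\<close>

definition cycle_in :: "nat set set \<Rightarrow> nat set set \<Rightarrow> bool" where
  "cycle_in E C \<longleftrightarrow> C \<subseteq> E \<and>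
     (\<exists>vs. length vs \<ge> 3 \<and> distinct vs \<and>
           C = {{vs ! i, vs ! (Suc i mod length vs)} | i. i < length vs})"

definition unicyclic :: "nat \<Rightarrow> nat set set \<Rightarrow> bool" where
  "unicyclic n E \<longleftrightarrow> simple_graph n E \<and> connected_graph n E \<and> (\<exists>!C. cycle_in E C)"

definition degree_in :: "nat set set \<Rightarrow> nat \<Rightarrow> nat" where
  "degree_in E v = card {e \<in> E. v \<in> e}"

definition average_degree :: "nat \<Rightarrow> nat set set \<Rightarrow> real" where
  "average_degree n E = (\<Sum>v<n. real (degree_in E v)) / real n"

definition degree_matrix :: "nat \<Rightarrow> nat set set \<Rightarrow> real mat" where
  "degree_matrix n E = mat n n (\<lambda>(i, j). if i = j then real (degree_in E i) else 0)"

definition adjacency_matrix :: "nat \<Rightarrow> nat set set \<Rightarrow> real mat" where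
  "adjacency_matrix n E = mat n n (\<lambda>(i, j). if {i, j} \<in> E then 1 else 0)"

definition laplacian :: "nat \<Rightarrow> nat set set \<Rightarrow> real mat" where
  "laplacian n E = degree_matrix n E - adjacency_matrix n E"

text \<open>
  The eigenvalues with their algebraic multiplicities. Since the Laplacian is real symmetric,
  no eigenvalue is lost by counting real roots only; see \<open>size_laplacian_spectrum\<close> below.
\<close>

definition laplacian_spectrum :: "nat \<Rightarrow> nat set set \<Rightarrow> real multiset" where
  "laplacian_spectrum n E = proots (char_poly (laplacian n E))"

definition cospectral :: "nat \<Rightarrow> nat set set \<Rightarrow> nat set set \<Rightarrow> bool" where
  "cospectral n E E' \<longleftrightarrow> laplacian_spectrum n E = laplacian_spectrum n E'"

definition laplacian_energy :: "nat \<Rightarrow> nat set set \<Rightarrow> real" where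
  "laplacian_energy n E = (\<Sum>\<mu>\<in>#laplacian_spectrum n E. \<bar>\<mu> - average_degree n E\<bar>)"

definition graph_iso :: "nat \<Rightarrow> nat set set \<Rightarrow> nat set set \<Rightarrow> bool" where
  "graph_iso n E E' \<longleftrightarrow> (\<exists>f. bij_betw f {..<n} {..<n} \<and> (`) f ` E = E')"

definition equienergetic_unicyclic_family :: "nat \<Rightarrow> nat \<Rightarrow> nat set set set \<Rightarrow> bool" where
  "equienergetic_unicyclic_family l n F \<longleftrightarrow>
     finite F \<and> card F = l \<and>
     (\<forall>E\<in>F. unicyclic n E) \<and>
     pairwise (\<lambda>E E'. \<not> cospectral n E E') F \<and>
     (\<forall>E\<in>F. \<forall>E'\<in>F. laplacian_energy n E = laplacian_energy n E')"

text \<open>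
  Families of graphs are compared up to isomorphism of their members, so that a mere
  relabelling of vertices does not produce a different family.
\<close>

definition same_family :: "nat \<Rightarrow> nat set set set \<Rightarrow> nat set set set \<Rightarrow> bool" where
  "same_family n F F' \<longleftrightarrow>
     (\<forall>E\<in>F. \<exists>E'\<in>F'. graph_iso n E E') \<and> (\<forall>E'\<in>F'. \<exists>E\<in>F. graph_iso n E E')"

lemma real_symmetric_eigenvalue_real:
  fixes A :: "real mat"
  assumes A: "A \<in> carrier_mat n n" and sym: "A\<^sup>T = A"
    and ev: "eigenvalue (map_mat complex_of_real A) a"
  shows "a \<in> \<real>"
proof -
  let ?B = "map_mat complex_of_real A"
  have B: "?B \<in> carrier_mat n n" using A by simp
  have symB: "?B\<^sup>T = ?B" using arg_cong[OF sym, of "map_mat complex_of_real"] map_mat_transpose[of complex_of_real A]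
    by simp
  from ev obtain v where v: "v \<in> carrier_vec n" "v \<noteq> 0\<^sub>v n" "?B *\<^sub>v v = a \<cdot>\<^sub>v v"
    using A unfolding eigenvalue_def eigenvector_def by auto
  have cv: "conjugate v \<in> carrier_vec n" using v by simp
  have cB: "?B *\<^sub>v conjugate v = conjugate (?B *\<^sub>v v)"
    using A v(1)
    by (intro eq_vecI)
      (auto simp: scalar_prod_def sum_conjugate conjugate_complex_def)
  have "a * (v \<bullet> conjugate v) = (?B *\<^sub>v v) \<bullet> conjugate v" using v cv by simp
  also have "\<dots> = v \<bullet> (?B *\<^sub>v conjugate v)"
    using transpose_vec_mult_scalar[OF B cv v(1)] symB v cv B
    by (metis comm_scalar_prod mult_mat_vec_carrier)
  also have "\<dots> = v \<bullet> (conjugate a \<cdot>\<^sub>v conjugate v)"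
    by (simp add: cB v conjugate_smult_vec)
  also have "\<dots> = conjugate a * (v \<bullet> conjugate v)" using v cv by simp
  finally have "a = conjugate a" using v by simp
  then show ?thesis by (simp add: conjugate_complex_def Reals_cnj_iff)
qed

lemma size_proots_char_poly_symmetric:
  fixes A :: "real mat"
  assumes A: "A \<in> carrier_mat n n" and sym: "A\<^sup>T = A"
  shows "size (proots (char_poly A)) = n"
proof -
  let ?B = "map_mat complex_of_real A"
  interpret P: map_poly_inj_comm_ring_hom complex_of_real ..
  have B: "?B \<in> carrier_mat n n" using A by simp
  from char_poly_factorized[OF B] obtain as
    where as: "char_poly ?B = (\<Prod>a\<leftarrow>as. [:- a, 1:])" "length as = n" by auto
  have "complex_of_real (Re a) = a" if "a \<in> set as" for a
  proof -
    have "poly (char_poly ?B) a = 0"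
      using that unfolding as(1) poly_prod_list by (auto simp: prod_list_zero_iff)
    then have "eigenvalue ?B a" using eigenvalue_root_char_poly[OF B] by simp
    then show ?thesis using real_symmetric_eigenvalue_real[OF A sym] by simp
  qed
  then have "(\<Prod>a\<leftarrow>as. [:- a, 1:]) =
      map_poly complex_of_real (\<Prod>a\<leftarrow>as. [:- Re a, 1:])"
    by (induction as) (auto simp: hom_distribs)
  then have "map_poly complex_of_real (char_poly A) =
      map_poly complex_of_real (\<Prod>a\<leftarrow>as. [:- Re a, 1:])"
    using as(1) of_real_hom.char_poly_hom[OF A, where ?'a = complex] by metis
  then have "char_poly A = (\<Prod>a\<leftarrow>as. [:- Re a, 1:])" by simp
  moreover have "size (proots (\<Prod>a\<leftarrow>bs. [:- Re a, 1:])) = length bs" for bs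
  proof (induction bs)
    case (Cons b bs)
    have "(\<Prod>a\<leftarrow>bs. [:- Re a, 1:]) \<noteq> 0" by (auto simp: prod_list_zero_iff)
    then show ?case
      using Cons.IH proots_mult[of "[:- Re b, 1:]" "\<Prod>a\<leftarrow>bs. [:- Re a, 1:]"]
      by (simp del: mult_pCons_left)
  qed simp
  ultimately show ?thesis using as(2) by simp
qed

lemma size_laplacian_spectrum: "size (laplacian_spectrum n E) = n"
  unfolding laplacian_spectrum_def
proof (rule size_proots_char_poly_symmetric)
  show "laplacian n E \<in> carrier_mat n n"
    unfolding laplacian_def degree_matrix_def adjacency_matrix_def by (intro minus_carrier_mat) simp
  show "(laplacian n E)\<^sup>T = laplacian n E"
    by (rule eq_matI)
      (auto simp: laplacian_def degree_matrix_def adjacency_matrix_def insert_commute)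
qed

end

(*
Attach to a hub two pendant paths of each of the lengths 1, ..., l, and let the graph number m arise
from this tree by joining the ends of the two paths of length m. The swap of these two paths splits
off an antisymmetric block: a path matrix with diagonal 2, ..., 2, 1 in the tree, which the new edge
turns into the one with diagonal 2, ..., 2, 3. Up to a change of signs the second is 4 minus the
first, so its eigenvalues are the reflections in 2, which is the average degree of a unicyclic graph;
hence all l graphs have the same Laplacian energy. Comparing the characteristic polynomials at 0
recovers the cycle length 2m + 1, so no two of the graphs are cospectral. The remaining vertices are
free; hanging them on the hub in two different ways gives the two families.
*)
theory Submission
  imports Defs
begin

subsection \<open>Determinants and real roots\<close>

text \<open>Stated with the extra factor \<open>c\<close> on the left to avoid the truncated exponent \<open>n - 1\<close>.\<close>

lemma det_scalar_plus_outer: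
  fixes u v :: "nat \<Rightarrow> 'a :: idom"
  shows "c * det (mat n n (\<lambda>(i, j). (if i = j then c else 0) + u i * v j)) =
    c ^ n * (c + (\<Sum>i<n. v i * u i))"
proof -
  let ?I = "1\<^sub>m n :: 'a mat"
  define U where "U = mat n 1 (\<lambda>(i, _). u i)"
  define V where "V = mat 1 n (\<lambda>(_, j). v j)"
  define N where "N = mat n n (\<lambda>(i, j). (if i = j then c else 0) + u i * v j)"
  \<comment> \<open>Column operations that eliminate \<open>V\<close> from the bordered matrix
    \<open>K\<close> show \<open>det K = det N\<close>. Row operations instead bring
    \<open>c + (\<Sum>i<n. v i * u i)\<close> into the corner; putting \<open>c\<close> into the
    corner of \<open>?L\<close> makes this possible without division.\<close>
  define K where "K = four_block_mat (c \<cdot>\<^sub>m ?I) (- U) V (1\<^sub>m 1)"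
  have carrier: "U \<in> carrier_mat n 1" "V \<in> carrier_mat 1 n" "N \<in> carrier_mat n n"
    by (auto simp: U_def V_def N_def)
  have K: "K \<in> carrier_mat (n + 1) (n + 1)" using carrier by (auto simp: K_def)
  let ?R = "four_block_mat ?I (0\<^sub>m n 1) (- V) (1\<^sub>m 1)"
  have "K * ?R = four_block_mat N (- U) (0\<^sub>m 1 n) (1\<^sub>m 1)"
    unfolding K_def using carrier
    by (subst mult_four_block_mat[OF _ _ _ _ one_carrier_mat zero_carrier_mat _ one_carrier_mat])
      (auto simp: N_def U_def V_def scalar_prod_def intro!: cong_four_block_mat)
  moreover have "det ?R = 1"
    using carrier by (subst det_four_block_mat_upper_right_zero[where n=n and m=1]) auto
  moreover have "det (four_block_mat N (- U) (0\<^sub>m 1 n) (1\<^sub>m 1)) = det N"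
    using carrier by (subst det_four_block_mat_lower_left_zero[where n=n and m=1]) auto
  moreover have "det (K * ?R) = det K * det ?R"
    using carrier by (intro det_mult[OF K]) auto
  ultimately have 1: "det K = det N" by simp
  let ?L = "four_block_mat ?I (0\<^sub>m n 1) (- V) (c \<cdot>\<^sub>m 1\<^sub>m 1)"
  let ?D = "mat 1 1 (\<lambda>_. c + (\<Sum>i<n. v i * u i))"
  have "V * (c \<cdot>\<^sub>m ?I) = c \<cdot>\<^sub>m V" "c \<cdot>\<^sub>m 1\<^sub>m 1 * V = c \<cdot>\<^sub>m V"
    using carrier(2) mult_smult_distrib[OF carrier(2) one_carrier_mat]
      mult_smult_assoc_mat[OF one_carrier_mat carrier(2)] by auto
  then have "- V * (c \<cdot>\<^sub>m ?I) + c \<cdot>\<^sub>m 1\<^sub>m 1 * V = 0\<^sub>m 1 n"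
    using carrier(2) by (auto simp: uminus_mult_left_mat[symmetric])
  then have "?L * K = four_block_mat (c \<cdot>\<^sub>m ?I) (- U) (0\<^sub>m 1 n) ?D"
    unfolding K_def using carrier
    by (subst mult_four_block_mat[OF one_carrier_mat zero_carrier_mat _ _ _ _ _ one_carrier_mat])
      (auto simp: U_def V_def scalar_prod_def lessThan_atLeast0 intro!: cong_four_block_mat)
  moreover have "det ?L = c"
    using carrier by (subst det_four_block_mat_upper_right_zero[where n=n and m=1]) auto
  moreover have "det (four_block_mat (c \<cdot>\<^sub>m ?I) (- U) (0\<^sub>m 1 n) ?D) = c ^ n * (c + (\<Sum>i<n. v i * u i))"
    using carrier by (subst det_four_block_mat_lower_left_zero[where n=n and m=1]) (auto simp: det_single)
  moreover have "det (?L * K) = det ?L * det K"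
    using carrier by (intro det_mult[OF _ K]) auto
  ultimately have "c * det K = c ^ n * (c + (\<Sum>i<n. v i * u i))" by simp
  with 1 show ?thesis by (simp add: N_def)
qed

text \<open>By the choice of \<open>w\<close>, multiplying \<open>X\<close> by c I + w d^T gives c
  (X - d d^T). Taking determinants yields a rank-one update formula free of the inverse of
  \<open>X\<close>.\<close>

lemma det_minus_outer:
  fixes X :: "'a :: idom mat"
  assumes X: "X \<in> carrier_mat n n"
    and w: "\<And>i. i < n \<Longrightarrow> (\<Sum>j<n. X $$ (i, j) * w j) = - c * d i"
    and c: "c \<noteq> 0"
  shows "c * det (mat n n (\<lambda>(i, j). X $$ (i, j) - d i * d j)) = (c + (\<Sum>i<n. d i * w i)) * det X"
proof -
  define N where "N = mat n n (\<lambda>(i, j). (if i = j then c else 0) + w i * d j)"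
  define Y where "Y = mat n n (\<lambda>(i, j). X $$ (i, j) - d i * d j)"
  have N: "N \<in> carrier_mat n n" and Y: "Y \<in> carrier_mat n n" by (auto simp: N_def Y_def)
  have "X * N = c \<cdot>\<^sub>m Y"
  proof (rule eq_matI)
    fix i j assume "i < dim_row (c \<cdot>\<^sub>m Y)" "j < dim_col (c \<cdot>\<^sub>m Y)"
    then have ij: "i < n" "j < n" using Y by auto
    have "(X * N) $$ (i, j) = (\<Sum>k<n. X $$ (i, k) * ((if k = j then c else 0) + w k * d j))"
      using X N ij by (auto simp: scalar_prod_def N_def lessThan_atLeast0)
    also have "\<dots> = (\<Sum>k<n. (if k = j then X $$ (i, k) * c else 0) + X $$ (i, k) * w k * d j)"
      by (intro sum.cong) (auto simp: algebra_simps)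
    also have "\<dots> = (\<Sum>k<n. (if k = j then X $$ (i, k) * c else 0)) + (\<Sum>k<n. X $$ (i, k) * w k) * d j"
      by (simp only: sum.distrib sum_distrib_right)
    also have "\<dots> = (c \<cdot>\<^sub>m Y) $$ (i, j)" using ij w[OF ij(1)] by (simp add: Y_def algebra_simps)
    finally show "(X * N) $$ (i, j) = (c \<cdot>\<^sub>m Y) $$ (i, j)" .
  qed (use X N Y in auto)
  then have "det X * det N = c ^ n * det Y" using det_mult[OF X N] Y by simp
  then have "c ^ n * ((c + (\<Sum>i<n. d i * w i)) * det X) = c ^ n * (c * det Y)"
    using det_scalar_plus_outer[of c n w d] unfolding N_def[symmetric]
    by (metis (no_types, lifting) mult.assoc mult.commute)
  with c show ?thesis by (simp add: Y_def)
qed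

section \<open>Polynomials along a path and their reflection\<close>

text \<open>
  The entries of an eigenvector along a path, as polynomials in the eigenvalue.
\<close>

fun chain_poly :: "nat \<Rightarrow> real poly" where
  "chain_poly 0 = 0"
| "chain_poly (Suc 0) = 1"
| "chain_poly (Suc (Suc k)) = [:2, -1:] * chain_poly (Suc k) - chain_poly k"

lemma poly_chain_poly_0: "poly (chain_poly k) 0 = real k"
  by (induction k rule: chain_poly.induct) auto

text \<open>\<open>chain_poly k\<close> is the Chebyshev polynomial of the second kind U_(k-1) at 1
  - x/2. Replacing x by 4 - x negates this argument, so the sign is the parity of U_(k-1).\<close>

lemma chain_poly_reflect:
  "pcompose (chain_poly k) [:4, -1:] = (-1) ^ Suc k * chain_poly k"
proof (induction k rule: chain_poly.induct)
  case (3 k)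
  define Q :: "real poly" where "Q = [:2, -1:]"
  have "pcompose Q [:4, -1:] = - Q" by (simp add: Q_def pcompose_pCons)
  then have "pcompose (Q * chain_poly (Suc k) - chain_poly k) [:4, -1:] =
      (-1) ^ Suc (Suc (Suc k)) * (Q * chain_poly (Suc k) - chain_poly k)"
    using 3 by (simp add: pcompose_diff pcompose_mult algebra_simps)
  then show ?case by (simp only: chain_poly.simps Q_def)
qed (auto simp: pcompose_1)

text \<open>Splitting off one real root at a time also covers polynomials with nonreal roots: a
  factor without real roots has none after the substitution either.\<close>

lemma proots_reflect:
  "proots (pcompose p [:c, -1:]) = image_mset (\<lambda>x. c - x) (proots (p :: real poly))"
proof (induction "degree p" arbitrary: p rule: less_induct)
  case less
  show ?case
  proof (cases "p \<noteq> 0 \<and> (\<exists>a. poly p a = 0)")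
    case True
    then obtain a q where pq: "p = [:-a, 1:] * q" and "p \<noteq> 0"
      by (auto simp: poly_eq_0_iff_dvd elim!: dvdE)
    then have q: "q \<noteq> 0" by auto
    have q': "pcompose q [:c, -1:] \<noteq> 0" using q pcompose_eq_0[of q "[:c, -1:]"] by auto
    have deg: "degree q < degree p" using q unfolding pq by (subst degree_mult_eq) auto
    have "pcompose [:-a, 1:] [:c, -1:] = - [:- (c - a), 1:]" by (simp add: pcompose_pCons)
    then have "pcompose p [:c, -1:] = - ([:- (c - a), 1:] * pcompose q [:c, -1:])"
      unfolding pq pcompose_mult by (simp only: mult_minus_left)
    then have "proots (pcompose p [:c, -1:]) = {#c - a#} + proots (pcompose q [:c, -1:])"
      using q' by (simp add: proots_mult del: mult_pCons_left)
    moreover have "proots p = {#a#} + proots q"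
      using q unfolding pq by (subst proots_mult) auto
    ultimately show ?thesis using less[OF deg] by simp
  next
    case False
    show ?thesis
    proof (cases "p = 0")
      case False
      with \<open>\<not> (p \<noteq> 0 \<and> _)\<close> have np: "\<And>a. poly p a \<noteq> 0" by auto
      then have "\<And>a. poly (pcompose p [:c, -1:]) a \<noteq> 0" by (simp add: poly_pcompose)
      moreover have "proots r = {#}" if "\<And>a. poly r a \<noteq> 0" for r :: "real poly"
      proof -
        have "r \<noteq> 0" using that[of 0] by auto
        then have "set_mset (proots r) = {}" using that by simp
        then show ?thesis by (simp only: set_mset_eq_empty_iff)
      qed
      ultimately show ?thesis using np by simp
    qed simp
  qed
qed

text \<open>Size equal to degree says that the polynomial splits, so common linear factors can be
  removed until both polynomials are 1. This turns equal spectra into equal characteristic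
  polynomials.\<close>

lemma split_monic_eqI:
  fixes p q :: "'a :: idom poly"
  assumes "monic p" "monic q" "proots p = proots q"
    and "size (proots p) = degree p" "size (proots q) = degree q"
  shows "p = q"
  using assms
proof (induction "degree p" arbitrary: p q)
  case 0
  then show ?case by (metis monic_degree_0)
next
  case (Suc d)
  from Suc.hyps(2) Suc.prems(4) have "proots p \<noteq> {#}" by auto
  then obtain a where a: "a \<in># proots p" by blast
  have nz: "p \<noteq> 0" "q \<noteq> 0" using Suc.prems(1,2) by auto
  have "poly p a = 0" "poly q a = 0" using a Suc.prems(3) set_count_proots[OF nz(1)] set_count_proots[OF nz(2)]
    by (metis mem_Collect_eq)+
  then obtain p' q' where pq: "p = [:-a, 1:] * p'" "q = [:-a, 1:] * q'"
    by (auto simp: poly_eq_0_iff_dvd elim!: dvdE)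
  then have nz': "p' \<noteq> 0" "q' \<noteq> 0" using nz by auto
  have deg: "degree p = Suc (degree p')" "degree q = Suc (degree q')"
    using nz' unfolding pq by (subst degree_mult_eq; simp)+
  have pr: "proots p = add_mset a (proots p')" "proots q = add_mset a (proots q')"
    using nz' unfolding pq by (subst proots_mult; simp)+
  have "p' = q'"
  proof (rule Suc.hyps(1))
    show "d = degree p'" using deg Suc.hyps(2) by simp
    show "monic p'" "monic q'" using Suc.prems(1,2) unfolding pq by (simp_all add: lead_coeff_mult del: mult_pCons_left)
  qed (use pr deg Suc.prems in auto)
  then show ?case by (simp add: pq)
qed

text \<open>Up to sign these are the characteristic polynomials of the path matrices of size
  \<open>k\<close> with diagonal 2, ..., 2, 1 and 2, ..., 2, 3. Their values at 0 are 1 and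
  \<open>2 * k + 1\<close>.\<close>

lemma chain_diff_nonzero: "chain_poly (Suc k) - chain_poly k \<noteq> 0"
  and chain_sum_nonzero: "chain_poly (Suc k) + chain_poly k \<noteq> 0"
proof -
  have "poly (chain_poly (Suc k) - chain_poly k) 0 \<noteq> 0"
    "poly (chain_poly (Suc k) + chain_poly k) 0 \<noteq> 0"
    by (simp_all add: poly_chain_poly_0 del: chain_poly.simps)
  then show "chain_poly (Suc k) - chain_poly k \<noteq> 0" "chain_poly (Suc k) + chain_poly k \<noteq> 0"
    by (metis poly_0)+
qed

text \<open>Consecutive chain polynomials have opposite parities under the reflection, which
  therefore turns their difference into their sum up to sign.\<close>

lemma proots_chain_sum:
  "proots (chain_poly (Suc k) + chain_poly k) =
    image_mset (\<lambda>x. 4 - x) (proots (chain_poly (Suc k) - chain_poly k))"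
proof -
  have "pcompose (chain_poly (Suc k) - chain_poly k) [:4, -1:] =
      (-1) ^ k * (chain_poly (Suc k) + chain_poly k)"
    unfolding pcompose_diff chain_poly_reflect by (simp add: algebra_simps del: chain_poly.simps)
  also have "\<dots> = Polynomial.smult ((-1) ^ k) (chain_poly (Suc k) + chain_poly k)"
    by (cases "even k") (simp_all del: chain_poly.simps)
  finally show ?thesis using proots_reflect[of "chain_poly (Suc k) - chain_poly k" 4] by simp
qed

subsection \<open>Laplacian matrices\<close>

definition outgoing :: "nat set set \<Rightarrow> nat \<Rightarrow> nat set" where
  "outgoing E i = {j. {i, j} \<in> E}"

lemma simple_graphD:
  assumes "simple_graph n E" "{i, j} \<in> E"
  shows "i < n" "j < n" "i \<noteq> j"
  using assms unfolding simple_graph_def by (auto dest!: bspec)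

lemma degree_in_eq_card_outgoing:
  assumes "simple_graph n E"
  shows "degree_in E i = card (outgoing E i)"
proof -
  have "{e \<in> E. i \<in> e} = (\<lambda>j. {i, j}) ` outgoing E i"
  proof (intro equalityI subsetI)
    fix e assume "e \<in> {e \<in> E. i \<in> e}"
    moreover from this assms have "card e = 2" by (auto simp: simple_graph_def)
    ultimately show "e \<in> (\<lambda>j. {i, j}) ` outgoing E i"
      by (auto simp: card_2_iff outgoing_def doubleton_eq_iff insert_commute)
  qed (auto simp: outgoing_def)
  moreover have "inj_on (\<lambda>j. {i, j}) (outgoing E i)" by (auto simp: inj_on_def doubleton_eq_iff)
  ultimately show ?thesis by (simp add: degree_in_def card_image)
qed

lemma sum_degree_in:
  assumes "simple_graph n E" "finite E"
  shows "(\<Sum>v<n. degree_in E v) = 2 * card E"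
proof -
  have "(\<Sum>v<n. degree_in E v) = (\<Sum>e\<in>E. card {v \<in> {..<n}. v \<in> e})"
    unfolding degree_in_def by (rule sum_multicount_gen) (use assms in auto)
  also have "\<dots> = (\<Sum>e\<in>E. 2)"
  proof (rule sum.cong)
    fix e assume "e \<in> E"
    with assms have "{v \<in> {..<n}. v \<in> e} = e" "card e = 2" by (auto simp: simple_graph_def)
    then show "card {v \<in> {..<n}. v \<in> e} = 2" by simp
  qed simp
  finally show ?thesis by simp
qed

lemma laplacian_carrier: "laplacian n E \<in> carrier_mat n n"
  unfolding laplacian_def degree_matrix_def adjacency_matrix_def by (intro minus_carrier_mat) simp

lemma laplacian_entry:
  assumes "i < n" "j < n"
  shows "laplacian n E $$ (i, j) =
    (if i = j then real (degree_in E i) else 0) - (if j \<in> outgoing E i then 1 else 0)"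
  using assms unfolding laplacian_def degree_matrix_def adjacency_matrix_def outgoing_def by simp

text \<open>The entries of \<open>w\<close> are polynomials in the eigenvalue, so one vector covers
  all eigenvalues at once; the differences absorb the diagonal degrees.\<close>

lemma laplacian_apply:
  fixes w :: "nat \<Rightarrow> real poly"
  assumes E: "simple_graph n E" and i: "i < n"
  shows "(\<Sum>j<n. [:laplacian n E $$ (i, j):] * w j) = (\<Sum>j\<in>outgoing E i. w i - w j)"
proof -
  have sub: "outgoing E i \<subseteq> {..<n}" using simple_graphD[OF E] by (auto simp: outgoing_def)
  have "(\<Sum>j<n. [:laplacian n E $$ (i, j):] * w j) =
      (\<Sum>j<n. (if i = j then of_nat (degree_in E i) * w j else 0) - (if j \<in> outgoing E i then w j else 0))"
    using i by (intro sum.cong) (auto simp: laplacian_entry of_nat_poly algebra_simps)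
  also have "\<dots> = of_nat (card (outgoing E i)) * w i - (\<Sum>j\<in>outgoing E i. w j)"
    using i sub by (simp add: sum_subtractf sum.If_cases degree_in_eq_card_outgoing[OF E] Int_absorb1)
  finally show ?thesis by (simp add: sum_subtractf)
qed

lemma char_poly_matrix_laplacian_apply:
  fixes w :: "nat \<Rightarrow> real poly"
  assumes E: "simple_graph n E" and i: "i < n"
  shows "(\<Sum>j<n. char_poly_matrix (laplacian n E) $$ (i, j) * w j) =
    [:0, 1:] * w i - (\<Sum>j\<in>outgoing E i. w i - w j)"
proof -
  have "(\<Sum>j<n. char_poly_matrix (laplacian n E) $$ (i, j) * w j) =
      (\<Sum>j<n. (if j = i then [:0, 1:] * w j else 0) - [:laplacian n E $$ (i, j):] * w j)"
    using i laplacian_carrier[of n E]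
    by (intro sum.cong) (auto simp: char_poly_matrix_def algebra_simps)
  then show ?thesis
    using i by (simp add: sum_subtractf laplacian_apply[OF E i] del: mult_pCons_left)
qed

text \<open>The new edge adds d d^T to the Laplacian, where d is 1 at \<open>a\<close> and -1 at
  \<open>b\<close>. As \<open>w\<close> solves the eigenvalue equation up to the defect p d, it is
  the vector that \<open>det_minus_outer\<close> asks for, with \<open>p\<close> as the
  constant.\<close>

lemma char_poly_laplacian_insert:
  fixes w :: "nat \<Rightarrow> real poly"
  assumes E: "simple_graph n E" and ab: "a < n" "b < n" "a \<noteq> b" "{a, b} \<notin> E"
    and eq: "\<And>i. i < n \<Longrightarrow> (\<Sum>j\<in>outgoing E i. w i - w j) =
      [:0, 1:] * w i + p * ((if i = a then 1 else 0) - (if i = b then 1 else 0))"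
    and p: "p \<noteq> 0"
  shows "p * char_poly (laplacian n (insert {a, b} E)) =
    (p + (w a - w b)) * char_poly (laplacian n E)"
proof -
  define d :: "nat \<Rightarrow> real poly" where "d i = (if i = a then 1 else 0) - (if i = b then 1 else 0)" for i
  let ?X = "char_poly_matrix (laplacian n E)"
  let ?E = "insert {a, b} E"
  have X: "?X \<in> carrier_mat n n" using laplacian_carrier by simp
  have E': "simple_graph n ?E" using E ab by (auto simp: simple_graph_def)
  have fin: "finite (outgoing E i)" for i
    by (rule finite_subset[of _ "{..<n}"]) (use simple_graphD[OF E] in \<open>auto simp: outgoing_def\<close>)
  have out: "outgoing ?E i = (if i = a then insert b (outgoing E i) else if i = b then insert a (outgoing E i)
      else outgoing E i)" for i
    using ab by (auto simp: outgoing_def doubleton_eq_iff)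
  have ab': "b \<notin> outgoing E a" "a \<notin> outgoing E b" using ab by (auto simp: outgoing_def insert_commute)
  have lap: "[:laplacian n ?E $$ (i, j):] = [:laplacian n E $$ (i, j):] + d i * d j" if "i < n" "j < n" for i j
    using that ab ab' fin
    by (auto simp: laplacian_entry degree_in_eq_card_outgoing[OF E] degree_in_eq_card_outgoing[OF E'] out d_def
        one_pCons)
  have "char_poly_matrix (laplacian n ?E) = mat n n (\<lambda>(i, j). ?X $$ (i, j) - d i * d j)"
  proof (rule eq_matI)
    fix i j assume "i < dim_row (mat n n (\<lambda>(i, j). ?X $$ (i, j) - d i * d j))"
      "j < dim_col (mat n n (\<lambda>(i, j). ?X $$ (i, j) - d i * d j))"
    then have ij: "i < n" "j < n" by auto
    have "[:- laplacian n ?E $$ (i, j):] = [:- laplacian n E $$ (i, j):] - d i * d j"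
      using arg_cong[OF lap[OF ij], of uminus] by simp
    then show "char_poly_matrix (laplacian n ?E) $$ (i, j) = mat n n (\<lambda>(i, j). ?X $$ (i, j) - d i * d j) $$ (i, j)"
      using ij laplacian_carrier[of n E] laplacian_carrier[of n ?E]
      by (simp add: char_poly_matrix_def)
  qed (use laplacian_carrier[of n ?E] in \<open>auto simp: char_poly_matrix_def\<close>)
  moreover have "(\<Sum>i<n. d i * w i) = w a - w b"
    using ab by (simp add: d_def left_diff_distrib sum_subtractf if_distrib[of "\<lambda>x. x * _"] cong: if_cong)
  moreover have "(\<Sum>j<n. ?X $$ (i, j) * w j) = - p * d i" if "i < n" for i
    using char_poly_matrix_laplacian_apply[OF E that, of w] eq[OF that] by (simp add: d_def)
  ultimately show ?thesis
    using det_minus_outer[OF X, of w p d] p unfolding char_poly_def by simp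
qed

section \<open>Cospectrality, and degrees under isomorphism\<close>

lemma size_proots_laplacian:
  "size (proots (char_poly (laplacian n E))) = degree (char_poly (laplacian n E))"
  using size_laplacian_spectrum[of n E] degree_monic_char_poly[OF laplacian_carrier]
  by (auto simp: laplacian_spectrum_def)

lemma cospectral_iff:
  "cospectral n E E' \<longleftrightarrow> char_poly (laplacian n E) = char_poly (laplacian n E')"
  using degree_monic_char_poly[OF laplacian_carrier]
  by (auto simp: cospectral_def laplacian_spectrum_def intro!: split_monic_eqI size_proots_laplacian)

lemma graph_iso_degree_in_le:
  assumes E: "simple_graph n E" "finite E'" and f: "bij_betw f {..<n} {..<n}" "(`) f ` E = E'" and v: "v < n"
  shows "degree_in E v \<le> degree_in E' (f v)"
  unfolding degree_in_def
proof (rule card_inj_on_le[where f = "(`) f"])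
  have "E \<subseteq> Pow {..<n}" using E by (auto simp: simple_graph_def)
  then show "inj_on ((`) f) {e \<in> E. v \<in> e}"
    using inj_on_image_Pow[OF bij_betw_imp_inj_on[OF f(1)]] by (auto intro: inj_on_subset)
qed (use f E in auto)

lemma char_poly_laplacian_nonzero: "char_poly (laplacian m E) \<noteq> 0"
  using degree_monic_char_poly[OF laplacian_carrier[of m E]] by auto

subsection \<open>Cycles\<close>

definition cycle_edges :: "nat list \<Rightarrow> nat set set" where
  "cycle_edges vs = {{vs ! i, vs ! (Suc i mod length vs)} | i. i < length vs}"

lemma cycle_in_iff:
  "cycle_in E C \<longleftrightarrow> C \<subseteq> E \<and> (\<exists>vs. length vs \<ge> 3 \<and> distinct vs \<and> C = cycle_edges vs)"
  by (simp add: cycle_in_def cycle_edges_def)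

lemma cycle_edges_subset: "e \<in> cycle_edges vs \<Longrightarrow> e \<subseteq> set vs"
  by (auto simp: cycle_edges_def intro!: nth_mem mod_less_divisor)

lemma mod_pred:
  assumes "i < (N :: nat)"
  shows "(i + N - 1) mod N = (if i = 0 then N - 1 else i - 1)"
  using assms by (cases i) simp_all

lemma mod_Suc_less:
  assumes "i < (N :: nat)"
  shows "Suc i mod N = (if Suc i = N then 0 else Suc i)"
  using assms by simp

text \<open>Distinctness lets vertices be identified with their positions. The cyclic predecessor
  adds the length before subtracting 1, so that position 0 is not truncated.\<close>

lemma in_cycle_edges_iff:
  assumes "distinct vs" "length vs \<ge> 3" "i < length vs"
  shows "{vs ! i, x} \<in> cycle_edges vs \<longleftrightarrow>
    x = vs ! (Suc i mod length vs) \<or> x = vs ! ((i + length vs - 1) mod length vs)"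
    (is "_ \<longleftrightarrow> x = vs ! ?s \<or> x = vs ! ?p")
proof
  let ?N = "length vs"
  assume "{vs ! i, x} \<in> cycle_edges vs"
  then obtain j where j: "j < ?N" "{vs ! i, x} = {vs ! j, vs ! (Suc j mod ?N)}"
    by (auto simp: cycle_edges_def)
  have N: "Suc j mod ?N < ?N" using assms(2) by (intro mod_less_divisor) linarith
  from j(2) consider "vs ! i = vs ! j" "x = vs ! (Suc j mod ?N)"
    | "vs ! i = vs ! (Suc j mod ?N)" "x = vs ! j"
    by (auto simp: doubleton_eq_iff)
  then show "x = vs ! ?s \<or> x = vs ! ?p"
  proof cases
    case 1
    then show ?thesis using assms j by (simp add: nth_eq_iff_index_eq)
  next
    case 2
    then have i: "i = Suc j mod ?N" using assms j N by (simp add: nth_eq_iff_index_eq)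
    have "j = ?p" using i j(1) unfolding mod_pred[OF assms(3)] mod_Suc_less[OF j(1)]
      by (auto split: if_splits)
    then show ?thesis using 2 by simp
  qed
next
  let ?N = "length vs"
  have p: "?p < ?N" "Suc ?p mod ?N = i"
    using assms(3) unfolding mod_pred[OF assms(3)] by auto
  assume "x = vs ! ?s \<or> x = vs ! ?p"
  then show "{vs ! i, x} \<in> cycle_edges vs"
    unfolding cycle_edges_def using assms p by (auto simp: insert_commute)
qed

text \<open>Length at least 3 keeps the successor and the predecessor of a position apart. Hence a
  vertex with only one possible neighbour lies on no cycle.\<close>

lemma cycle_two_neighbours:
  assumes "distinct vs" "length vs \<ge> 3" "v \<in> set vs"
  obtains x y where "x \<noteq> y" "{v, x} \<in> cycle_edges vs" "{v, y} \<in> cycle_edges vs"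
proof -
  from assms(3) obtain i where i: "i < length vs" "v = vs ! i" by (auto simp: in_set_conv_nth)
  let ?N = "length vs"
  have "Suc i mod ?N \<noteq> (i + ?N - 1) mod ?N"
    using assms(2) i(1) unfolding mod_pred[OF i(1)] mod_Suc_less[OF i(1)] by auto
  moreover have "Suc i mod ?N < ?N" "(i + ?N - 1) mod ?N < ?N" using assms by (auto intro!: mod_less_divisor)
  ultimately have "vs ! (Suc i mod ?N) \<noteq> vs ! ((i + ?N - 1) mod ?N)"
    using assms by (simp add: nth_eq_iff_index_eq)
  then show ?thesis using that in_cycle_edges_iff[OF assms(1,2) i(1)] i(2) by blast
qed

text \<open>A vertex of the smaller cycle already uses both edges that the larger one offers there.
  So its positions on \<open>us\<close> are closed under successors, and walking around reaches all
  of \<open>us\<close>.\<close>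

lemma cycle_edges_subset_imp_eq:
  assumes vs: "distinct vs" "length vs \<ge> 3" and us: "distinct us" "length us \<ge> 3"
    and sub: "cycle_edges vs \<subseteq> cycle_edges us"
  shows "cycle_edges vs = cycle_edges us"
proof -
  let ?N = "length us"
  have step: "{us ! i, us ! (Suc i mod ?N)} \<in> cycle_edges vs" if i: "i < ?N" "us ! i \<in> set vs" for i
  proof -
    obtain x y where xy: "x \<noteq> y" "{us ! i, x} \<in> cycle_edges vs" "{us ! i, y} \<in> cycle_edges vs"
      using cycle_two_neighbours[OF vs i(2)] by metis
    then have "{us ! i, x} \<in> cycle_edges us" "{us ! i, y} \<in> cycle_edges us"
      using sub by (simp_all only: subsetD)
    then have "us ! (Suc i mod ?N) = x \<or> us ! (Suc i mod ?N) = y"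
      using xy(1) in_cycle_edges_iff[OF us i(1), of x] in_cycle_edges_iff[OF us i(1), of y] by metis
    then show ?thesis using xy(2,3) by metis
  qed
  have "vs ! 0 \<in> set vs" using vs(2) by (intro nth_mem) linarith
  then obtain x where "{vs ! 0, x} \<in> cycle_edges vs" using cycle_two_neighbours[OF vs] by metis
  then have "vs ! 0 \<in> set us" using sub cycle_edges_subset by blast
  then obtain k where k: "k < ?N" "us ! k \<in> set vs" using \<open>vs ! 0 \<in> set vs\<close> by (metis in_set_conv_nth)
  have reach: "us ! ((k + t) mod ?N) \<in> set vs" for t
  proof (induction t)
    case (Suc t)
    have "(k + t) mod ?N < ?N" using us(2) by (intro mod_less_divisor) linarith
    from step[OF this Suc] have "us ! (Suc ((k + t) mod ?N) mod ?N) \<in> set vs"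
      using cycle_edges_subset by blast
    then show ?case by (simp add: mod_Suc_eq)
  qed (use k in simp)
  \<comment> \<open>Modulo \<open>?N\<close>, the offset \<open>i + ?N - k\<close> leads from
    position \<open>k\<close> to position \<open>i\<close>, also when \<open>i < k\<close>.\<close>
  have "us ! i \<in> set vs" if "i < ?N" for i
    using reach[of "i + ?N - k"] that k by simp
  then show ?thesis using step sub by (auto simp: cycle_edges_def[of us])
qed

section \<open>Trees described by parent functions\<close>

definition parent_tree :: "nat \<Rightarrow> (nat \<Rightarrow> nat) \<Rightarrow> nat set set" where
  "parent_tree n par = (\<lambda>v. {v, par v}) ` {1..<n}"

text \<open>Parents have smaller labels, so 0 is the root: connectedness follows by induction on
  labels, and cycles are controlled through their largest vertex.\<close>

locale parent_function =
  fixes n :: nat and par :: "nat \<Rightarrow> nat"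
  assumes n_pos: "0 < n"
    and par_less: "\<And>v. 1 \<le> v \<Longrightarrow> v < n \<Longrightarrow> par v < v"
begin

abbreviation T :: "nat set set" where "T \<equiv> parent_tree n par"

lemma simple_graph_tree: "simple_graph n T"
  using par_less by (fastforce simp: simple_graph_def parent_tree_def card_2_iff)

lemma finite_tree: "finite T"
  by (simp add: parent_tree_def)

text \<open>The child is the larger end of its edge, so different vertices contribute different
  edges.\<close>

lemma card_tree: "card T = n - 1"
proof -
  have "inj_on (\<lambda>v. {v, par v}) {1..<n}"
  proof (rule inj_onI)
    fix u v assume uv: "u \<in> {1..<n}" "v \<in> {1..<n}" "{u, par u} = {v, par v}"
    then have "par u < u" "par v < v" using par_less by auto
    then show "u = v" using uv(3) by (auto simp: doubleton_eq_iff)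
  qed
  then show ?thesis by (simp add: parent_tree_def card_image)
qed

lemma in_tree_iff:
  "{i, j} \<in> T \<longleftrightarrow> 1 \<le> i \<and> i < n \<and> j = par i \<or> 1 \<le> j \<and> j < n \<and> i = par j"
  by (auto simp: parent_tree_def doubleton_eq_iff)

lemma outgoing_tree:
  assumes "i < n"
  shows "outgoing T i = (if i = 0 then {} else {par i}) \<union> {j. 1 \<le> j \<and> j < n \<and> par j = i}"
  using assms by (auto simp: outgoing_def in_tree_iff)

lemma connected_graph_tree:
  assumes "T \<subseteq> E"
  shows "connected_graph n E"
proof -
  let ?R = "{(x, y). {x, y} \<in> E}"
  have "sym ?R" by (auto simp: sym_def insert_commute)
  have to0: "(v, 0) \<in> ?R\<^sup>*" if "v < n" for v
    using that
  proof (induction v rule: less_induct)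
    case (less v)
    show ?case
    proof (cases "v = 0")
      case False
      then have "par v < v" using less.prems par_less by simp
      moreover have "(v, par v) \<in> ?R" using False less.prems assms by (auto simp: parent_tree_def)
      ultimately show ?thesis using less by (meson converse_rtrancl_into_rtrancl less_trans)
    qed simp
  qed
  moreover have "(0, v) \<in> ?R\<^sup>*" if "v < n" for v
    using to0[OF that] sym_rtrancl[OF \<open>sym ?R\<close>] by (auto dest: symD)
  ultimately show ?thesis using n_pos unfolding connected_graph_def by (meson rtrancl_trans)
qed

text \<open>Since \<open>set us\<close> is closed under parents and contains both ends of the new
  edge, the rest of the graph only consists of trees hanging on it. A cycle is thus confined to
  \<open>set us\<close>, where all edges belong to \<open>us\<close>.\<close>

lemma unicyclic_insert:
  assumes ab: "a < n" "b < n" "a \<noteq> b"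
    and us: "distinct us" "length us \<ge> 3" "cycle_edges us \<subseteq> insert {a, b} T"
    and closed: "a \<in> set us" "b \<in> set us" "\<And>v. v \<in> set us \<Longrightarrow> 1 \<le> v \<Longrightarrow> par v \<in> set us"
    and induced: "\<And>e. e \<in> insert {a, b} T \<Longrightarrow> e \<subseteq> set us \<Longrightarrow> e \<in> cycle_edges us"
  shows "unicyclic n (insert {a, b} T)"
proof -
  let ?E = "insert {a, b} T"
  have "C = cycle_edges us" if C: "cycle_in ?E C" for C
  proof -
    from C obtain vs where vs: "distinct vs" "length vs \<ge> 3" "C = cycle_edges vs" "C \<subseteq> ?E"
      by (auto simp: cycle_in_iff)
    have "set vs \<subseteq> set us"
    proof (rule ccontr)
      assume outside: "\<not> set vs \<subseteq> set us"
      define D where "D = set vs - set us"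
      have D: "finite D" "D \<noteq> {}" using outside by (auto simp: D_def)
      \<comment> \<open>A child of this largest outside vertex would again lie outside
        \<open>us\<close>, by closure under parents, and have a larger label. On the cycle only the
        parent remains as a neighbour.\<close>
      define v where "v = Max D"
      have v: "v \<in> D" and max: "\<And>z. z \<in> D \<Longrightarrow> z \<le> v" using D by (auto simp: v_def)
      obtain x y where xy: "x \<noteq> y" "{v, x} \<in> C" "{v, y} \<in> C"
        using cycle_two_neighbours[OF vs(1,2), of v] v vs(3) unfolding D_def by auto
      have "z = par v" if z: "{v, z} \<in> C" for z
      proof (rule ccontr)
        assume "z \<noteq> par v"
        moreover have "{v, z} \<in> T" using z vs(4) v closed(1,2) by (auto simp: D_def doubleton_eq_iff)
        ultimately have pz: "1 \<le> z" "z < n" "par z = v" by (auto simp: in_tree_iff)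
        then have "z \<notin> set us" using closed(3)[of z] v by (auto simp: D_def)
        moreover have "z \<in> set vs" using cycle_edges_subset[of "{v, z}" vs] z vs(3) by simp
        ultimately have "z \<le> v" using max by (simp add: D_def)
        then show False using par_less[OF pz(1,2)] pz(3) by simp
      qed
      then show False using xy by metis
    qed
    have "C \<subseteq> cycle_edges us"
    proof
      fix e assume "e \<in> C"
      then have "e \<subseteq> set us" using cycle_edges_subset[of e vs] vs(3) \<open>set vs \<subseteq> set us\<close> by simp
      with \<open>e \<in> C\<close> show "e \<in> cycle_edges us" using induced[of e] vs(4) by blast
    qed
    then show ?thesis using cycle_edges_subset_imp_eq[OF vs(1,2) us(1,2)] vs(3) by metis
  qed
  moreover have "cycle_in ?E (cycle_edges us)" unfolding cycle_in_iff using us by blast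
  moreover have "simple_graph n ?E"
    using simple_graph_tree ab by (auto simp: simple_graph_def)
  ultimately show ?thesis
    unfolding unicyclic_def using connected_graph_tree[of ?E] by (metis subset_insertI)
qed

end

subsection \<open>Trees with paired pendant paths\<close>

text \<open>
  The vertices \<open>block k + 1, \<dots>, block (Suc k)\<close> form the two pendant paths of length \<open>Suc k\<close>.
\<close>

definition block :: "nat \<Rightarrow> nat" where
  "block k = k * Suc k"

lemma block_Suc: "block (Suc k) = block k + 2 * k + 2"
  by (simp add: block_def)

lemma block_mono: "j \<le> k \<Longrightarrow> block j \<le> block k"
  unfolding block_def by (intro mult_le_mono) auto

text \<open>The two paths of a block are interleaved, hence the steps of 2. The last condition keeps
  the remaining vertices from being attached to the paths; they may form any trees at the hub
  0.\<close>

locale paired_paths = parent_function +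
  fixes l :: nat
  assumes n_gt: "block l < n"
    and par_first: "\<And>k. k < l \<Longrightarrow> par (block k + 1) = 0" "\<And>k. k < l \<Longrightarrow> par (block k + 2) = 0"
    and par_step: "\<And>k v. k < l \<Longrightarrow> block k + 2 < v \<Longrightarrow> v \<le> block (Suc k) \<Longrightarrow> par v = v - 2"
    and par_rest: "\<And>v. block l < v \<Longrightarrow> v < n \<Longrightarrow> par v = 0 \<or> block l < par v"
begin

text \<open>The two largest labels of a block are the ends of its two paths. The new edge closes a
  cycle through the hub with \<open>2 * k + 3\<close> vertices.\<close>

definition joined :: "nat \<Rightarrow> nat set set" where
  "joined k = insert {block (Suc k) - 1, block (Suc k)} T"

lemma block_less: "k < l \<Longrightarrow> block (Suc k) < n"
  using block_mono[of "Suc k" l] n_gt by simp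

lemma vertex_cases:
  assumes "1 \<le> v" "v < n"
  obtains (block) k where "k < l" "block k < v" "v \<le> block (Suc k)" | (rest) "block l < v"
proof (cases "v \<le> block l")
  case True
  define k where "k = (LEAST k. v \<le> block k)"
  have k: "v \<le> block k" unfolding k_def by (rule LeastI[of _ l]) (rule True)
  then obtain j where j: "k = Suc j" using assms by (cases k) (auto simp: block_def)
  have "\<not> v \<le> block j" using not_less_Least[of j "\<lambda>k. v \<le> block k"] j by (simp add: k_def)
  moreover have "k \<le> l" unfolding k_def by (rule Least_le) (rule True)
  ultimately show ?thesis using block k j by (auto intro: that(1)[of j])
qed (use that in auto)

lemma par_in_block:
  assumes "k < l" "block k < v" "v \<le> block (Suc k)"
  shows "par v = 0 \<or> block k < par v \<and> par v \<le> block (Suc k)"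
proof -
  consider "v = block k + 1" | "v = block k + 2" | "block k + 2 < v" using assms by linarith
  then show ?thesis using assms par_first par_step[of k v] by cases auto
qed

text \<open>Blocks are disjoint intervals, parents stay in the block or are the hub, and the
  remaining vertices have parents outside all blocks; so nothing else hangs on the paths.\<close>

lemma par_eq_imp_block:
  assumes "k < l" "1 \<le> j" "j < n" "block k < par j" "par j \<le> block (Suc k)"
  shows "block k < j" "j \<le> block (Suc k)"
proof -
  have "block k < j \<and> j \<le> block (Suc k)"
  proof (cases rule: vertex_cases[OF assms(2,3)])
    case (1 k')
    have *: "block k' < par j" "par j \<le> block (Suc k')" using par_in_block[OF 1] assms(4) by auto
    have "k = k'"
    proof (rule ccontr)
      assume "k \<noteq> k'"
      then have "Suc k \<le> k' \<or> Suc k' \<le> k" by auto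
      then have "block (Suc k) \<le> block k' \<or> block (Suc k') \<le> block k" using block_mono by blast
      then show False using * assms(4,5) by auto
    qed
    then show ?thesis using 1 by simp
  next
    case 2
    then have "block l < par j" using par_rest[of j] assms by auto
    then show ?thesis using block_mono[of "Suc k" l] assms by auto
  qed
  then show "block k < j" "j \<le> block (Suc k)" by auto
qed

text \<open>
  The antisymmetric vector on the two paths of block \<open>k\<close>: within the block the two paths
  are interleaved, the odd labels belonging to one of them and the even labels to the other.
\<close>

definition skew :: "nat \<Rightarrow> nat \<Rightarrow> real poly" where
  "skew k v = (if block k < v \<and> v \<le> block (Suc k)
     then (if odd v then 1 else -1) * chain_poly (Suc ((v - block k - 1) div 2)) else 0)"

text \<open>This is why the parity of a label tells the two paths of a block apart.\<close>

lemma even_block: "even (block k)"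
  by (simp add: block_def)

lemma skew_odd: "t \<le> k \<Longrightarrow> skew k (block k + 1 + 2 * t) = chain_poly (Suc t)"
  using even_block[of k] by (simp add: skew_def block_Suc)

lemma skew_even: "t \<le> k \<Longrightarrow> skew k (block k + 2 + 2 * t) = - chain_poly (Suc t)"
  using even_block[of k] by (simp add: skew_def block_Suc)

lemma skew_outside: "v \<le> block k \<or> block (Suc k) < v \<Longrightarrow> skew k v = 0"
  by (auto simp: skew_def)

text \<open>Coordinates in a block: \<open>e\<close> selects the path, and \<open>t\<close> is the
  distance from its first vertex.\<close>

lemma block_vertex_cases:
  assumes "block k < v" "v \<le> block (Suc k)"
  obtains t e where "t \<le> k" "e = 1 \<or> e = 2" "v = block k + e + 2 * t"
proof -
  define r where "r = v - block k - 1"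
  have "v = block k + (if even r then 1 else 2) + 2 * (r div 2)"
    using assms(1) unfolding r_def by (auto elim!: evenE oddE)
  moreover have "r div 2 \<le> k" using assms unfolding r_def block_Suc by auto
  ultimately show ?thesis by (intro that[of "r div 2" "if even r then 1 else 2"]) auto
qed

lemma skew_vertex:
  assumes "t \<le> k" "e = 1 \<or> e = 2"
  shows "skew k (block k + e + 2 * t) = (if e = 1 then 1 else -1) * chain_poly (Suc t)"
  using assms skew_odd[of t k] skew_even[of t k] by auto

lemma par_vertex:
  assumes "k < l" "t \<le> k" "e = 1 \<or> e = 2"
  shows "par (block k + e + 2 * t) = (if t = 0 then 0 else block k + e + 2 * (t - 1))"
proof (cases t)
  case (Suc t')
  have "par (block k + e + 2 * t) = block k + e + 2 * t - 2"
    using assms Suc by (intro par_step[OF assms(1)]) (auto simp: block_Suc)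
  then show ?thesis using Suc by auto
qed (use assms par_first in auto)

lemma children_vertex:
  assumes "k < l" "t \<le> k" "e = 1 \<or> e = 2"
  shows "{j. 1 \<le> j \<and> j < n \<and> par j = block k + e + 2 * t} =
    (if t < k then {block k + e + 2 * Suc t} else {})" (is "?S = _")
proof -
  have *: "t < k \<and> j = block k + e + 2 * Suc t" if "j \<in> ?S" for j
  proof -
    have j: "1 \<le> j" "j < n" "par j = block k + e + 2 * t" using that by auto
    then have b: "block k < par j" "par j \<le> block (Suc k)" using assms by (auto simp: block_Suc)
    obtain t' e' where t': "t' \<le> k" "e' = 1 \<or> e' = 2" "j = block k + e' + 2 * t'"
      using block_vertex_cases[OF par_eq_imp_block[OF assms(1) j(1,2) b]] by metis
    then have eq: "(if t' = 0 then 0 else block k + e' + 2 * (t' - 1)) = block k + e + 2 * t"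
      using par_vertex[OF assms(1) t'(1,2)] j(3) by simp
    then have "t' \<noteq> 0" using assms(3) by (cases "t' = 0") auto
    then have "e' + 2 * (t' - 1) = e + 2 * t" using eq by auto
    then have "e' = e" "t' = Suc t" using assms(3) t'(2) \<open>t' \<noteq> 0\<close> by presburger+
    then show ?thesis using t' by auto
  qed
  moreover have "block k + e + 2 * Suc t \<in> ?S" if "t < k"
  proof -
    have "block k + e + 2 * Suc t \<le> block (Suc k)" using that assms by (auto simp: block_Suc)
    then show ?thesis using par_vertex[OF assms(1), of "Suc t" e] that assms block_less[OF assms(1)] by auto
  qed
  ultimately show ?thesis by auto
qed

text \<open>Only at the two path ends, where the degree drops to 1, is the eigenvalue equation violated.\<close>

lemma skew_eigen:
  assumes k: "k < l" and i: "i < n"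
  shows "(\<Sum>j\<in>outgoing T i. skew k i - skew k j) = [:0, 1:] * skew k i +
    (chain_poly (Suc (Suc k)) - chain_poly (Suc k)) *
      ((if i = block (Suc k) - 1 then 1 else 0) - (if i = block (Suc k) then 1 else 0))"
proof -
  consider (zero) "i = 0" | (block) t e where "t \<le> k" "e = 1 \<or> e = 2" "i = block k + e + 2 * t"
    | (outside) "i \<noteq> 0" "i \<le> block k \<or> block (Suc k) < i"
    using block_vertex_cases[of k i] by (metis not_le_imp_less)
  then show ?thesis
  proof cases
    case zero
    let ?S = "{j. 1 \<le> j \<and> j < n \<and> par j = 0}"
    let ?D = "{block k + 1, block k + 2}"
    \<comment> \<open>Of the neighbours of the hub only the first vertices of the two paths carry
      nonzero values, and these cancel.\<close>
    have "(\<Sum>j\<in>?S. skew k j) = (\<Sum>j\<in>?D. skew k j)"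
    proof (rule sum.mono_neutral_right)
      show "?D \<subseteq> ?S" using par_first[OF k] block_less[OF k] by (auto simp: block_Suc)
      show "\<forall>j\<in>?S - ?D. skew k j = 0"
      proof
        fix j assume j: "j \<in> ?S - ?D"
        show "skew k j = 0"
        proof (rule ccontr)
          assume "skew k j \<noteq> 0"
          then have "block k < j" "j \<le> block (Suc k)" by (auto simp: skew_def split: if_splits)
          then have "par j = j - 2" "2 < j" using j par_step[OF k, of j] by auto
          then show False using j by auto
        qed
      qed
    qed (rule finite_subset[of _ "{..<n}"], auto)
    also have "\<dots> = 0" using skew_odd[of 0 k] skew_even[of 0 k] by simp
    finally show ?thesis
      using zero i by (simp add: outgoing_tree skew_outside block_Suc sum_negf)
  next
    case block
    let ?s = "if e = 1 then 1 else -1 :: real poly"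
    \<comment> \<open>For \<open>t = 0\<close> the parent is the hub, where the vector vanishes in
      accordance with \<open>chain_poly 0 = 0\<close>.\<close>
    have par_t: "skew k (par i) = ?s * chain_poly t"
      using block par_vertex[OF k block(1,2)] skew_vertex[OF _ block(2), of "t - 1" k]
      by (cases t) (auto simp: skew_outside)
    have "i \<noteq> 0" using block by auto
    have "finite {j. 1 \<le> j \<and> j < n \<and> par j = i}" "par i \<notin> {j. 1 \<le> j \<and> j < n \<and> par j = i}"
      using par_less[of i] par_less[of "par i"] i \<open>i \<noteq> 0\<close> by auto
    then have "(\<Sum>j\<in>outgoing T i. skew k i - skew k j) =
        (skew k i - skew k (par i)) + (\<Sum>j | 1 \<le> j \<and> j < n \<and> par j = i. skew k i - skew k j)"
      using i \<open>i \<noteq> 0\<close> by (simp add: outgoing_tree)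
    also have "\<dots> = ?s * (chain_poly (Suc t) - chain_poly t) +
        (if t < k then ?s * (chain_poly (Suc t) - chain_poly (Suc (Suc t))) else 0)"
      using skew_vertex[OF block(1,2)] skew_vertex[OF _ block(2), of "Suc t" k]
        children_vertex[OF k block(1,2)] par_t
      unfolding block(3) by (simp del: chain_poly.simps add: algebra_simps)
    also have "\<dots> = [:0, 1:] * skew k i + (chain_poly (Suc (Suc k)) - chain_poly (Suc k)) *
        ((if i = block (Suc k) - 1 then 1 else 0) - (if i = block (Suc k) then 1 else 0))"
    proof (cases "t < k")
      case True
      then have "i \<noteq> block (Suc k) - 1" "i \<noteq> block (Suc k)"
        using block unfolding block_Suc by presburger+
      then show ?thesis
        using True skew_vertex[OF block(1,2)] block(3) by (auto simp: algebra_simps)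
    next
      case False
      \<comment> \<open>At an end the recursion lacks the term of a next vertex; this is the defect,
        with opposite signs on the two paths.\<close>
      then have "t = k" using block by simp
      then have "((if i = block (Suc k) - 1 then 1 else 0) - (if i = block (Suc k) then 1 else 0)) = ?s"
        using block(2,3) by (auto simp: block_Suc)
      then show ?thesis
        using \<open>t = k\<close> skew_vertex[OF block(1,2)] block(3) by (auto simp: algebra_simps)
    qed
    finally show ?thesis .
  next
    case outside
    \<comment> \<open>A neighbour inside the block would force \<open>i\<close> to be in the block
      or to be the hub.\<close>
    have "skew k j = 0" if j: "j \<in> outgoing T i" for j
    proof (rule ccontr)
      assume "skew k j \<noteq> 0"
      then have b: "block k < j" "j \<le> block (Suc k)" by (auto simp: skew_def split: if_splits)
      from j i outside(1) consider "j = par i" | "1 \<le> j" "j < n" "par j = i" by (auto simp: outgoing_tree)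
      then show False
      proof cases
        case 1
        then show False using par_eq_imp_block[OF k, of i] b i outside by auto
      next
        case 2
        then show False using par_in_block[OF k b] outside by auto
      qed
    qed
    moreover have "skew k i = 0" using outside(2) by (rule skew_outside)
    moreover have "i \<noteq> block (Suc k) - 1" "i \<noteq> block (Suc k)" using outside by (auto simp: block_Suc)
    ultimately show ?thesis by simp
  qed
qed

section \<open>Spectrum and energy after joining two ends\<close>

lemma ends_not_adjacent:
  assumes "k < l"
  shows "{block (Suc k) - 1, block (Suc k)} \<notin> T"
proof
  assume "{block (Suc k) - 1, block (Suc k)} \<in> T"
  moreover have "par (block (Suc k)) \<noteq> block (Suc k) - 1" "par (block (Suc k) - 1) \<noteq> block (Suc k)"
    using par_vertex[OF assms, of k 1] par_vertex[OF assms, of k 2] by (auto simp: block_Suc split: if_splits)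
  ultimately show False by (auto simp: in_tree_iff)
qed

text \<open>Joining the ends exchanges the antisymmetric factor of the tree for its reflection. The
  cross-multiplied form avoids factoring either characteristic polynomial.\<close>

lemma char_poly_joined:
  assumes "k < l"
  shows "(chain_poly (Suc (Suc k)) - chain_poly (Suc k)) * char_poly (laplacian n (joined k)) =
    (chain_poly (Suc (Suc k)) + chain_poly (Suc k)) * char_poly (laplacian n T)"
proof -
  let ?a = "block (Suc k) - 1" and ?b = "block (Suc k)"
  let ?p = "chain_poly (Suc (Suc k)) - chain_poly (Suc k)"
  have "poly ?p 0 = 1" by (simp add: poly_chain_poly_0 del: chain_poly.simps)
  then have "?p \<noteq> 0" by (metis poly_0 zero_neq_one)
  \<comment> \<open>Adding this to the difference \<open>?p\<close> produces the sum of the two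
    chain polynomials.\<close>
  moreover have "skew k ?a - skew k ?b = 2 * chain_poly (Suc k)"
    using skew_odd[of k k] skew_even[of k k] by (simp add: block_Suc)
  ultimately show ?thesis
    using char_poly_laplacian_insert[OF simple_graph_tree, of ?a ?b "skew k" ?p]
      ends_not_adjacent[OF assms] block_less[OF assms] skew_eigen[OF assms]
    by (simp add: joined_def block_Suc algebra_simps del: chain_poly.simps)
qed

text \<open>The spectra agree after adding the roots of the difference factor to one and their
  reflections to the other. Reflection in 2 preserves the distance to 2, so the added contributions
  cancel.\<close>

lemma energy_joined:
  assumes "k < l"
  shows "(\<Sum>\<mu>\<in>#laplacian_spectrum n (joined k). \<bar>\<mu> - 2\<bar>) = (\<Sum>\<mu>\<in>#laplacian_spectrum n T. \<bar>\<mu> - 2\<bar>)"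
proof -
  let ?p = "chain_poly (Suc (Suc k)) - chain_poly (Suc k)"
  let ?e = "\<lambda>A :: real multiset. \<Sum>\<mu>\<in>#A. \<bar>\<mu> - 2\<bar>"
  let ?g = "char_poly (laplacian n (joined k))"
  have "proots ?p + proots ?g = proots (?p * ?g)"
    by (intro proots_mult[symmetric] chain_diff_nonzero char_poly_laplacian_nonzero)
  also have "\<dots> = proots ((chain_poly (Suc (Suc k)) + chain_poly (Suc k)) * char_poly (laplacian n T))"
    by (simp only: char_poly_joined[OF assms])
  also have "\<dots> = image_mset (\<lambda>x. 4 - x) (proots ?p) + proots (char_poly (laplacian n T))"
    by (subst proots_mult)
      (simp_all only: chain_sum_nonzero char_poly_laplacian_nonzero proots_chain_sum not_False_eq_True)
  finally have "proots ?p + laplacian_spectrum n (joined k) =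
      image_mset (\<lambda>x. 4 - x) (proots ?p) + laplacian_spectrum n T"
    by (simp only: laplacian_spectrum_def)
  then have "?e (proots ?p + laplacian_spectrum n (joined k)) =
      ?e (image_mset (\<lambda>x. 4 - x) (proots ?p) + laplacian_spectrum n T)" by simp
  moreover have "?e (image_mset (\<lambda>x. 4 - x) (proots ?p)) = ?e (proots ?p)"
    by (simp add: image_mset.compositionality comp_def abs_minus_commute del: chain_poly.simps)
  ultimately show ?thesis by (simp del: chain_poly.simps)
qed

lemma simple_graph_joined: "k < l \<Longrightarrow> simple_graph n (joined k)"
  using simple_graph_tree block_less[of k] by (auto simp: simple_graph_def joined_def block_Suc)

lemma finite_joined: "finite (joined k)"
  by (simp add: joined_def finite_tree)

lemma average_degree_joined:
  assumes "k < l"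
  shows "average_degree n (joined k) = 2"
proof -
  have "card (joined k) = n"
    using ends_not_adjacent[OF assms] n_pos by (simp add: joined_def finite_tree card_tree)
  then have "(\<Sum>v<n. degree_in (joined k) v) = 2 * n"
    using sum_degree_in[OF simple_graph_joined[OF assms] finite_joined] by simp
  then show ?thesis
    unfolding average_degree_def of_nat_sum[symmetric] using n_pos by simp
qed

lemma laplacian_energy_joined:
  "k < l \<Longrightarrow> laplacian_energy n (joined k) = (\<Sum>\<mu>\<in>#laplacian_spectrum n T. \<bar>\<mu> - 2\<bar>)"
  by (simp add: laplacian_energy_def average_degree_joined energy_joined)

text \<open>
  At 0 the two factors in \<open>char_poly_joined\<close> take the values 1 and \<open>2 * k + 3\<close>, the
  length of the cycle.
\<close>

lemma not_cospectral_joined: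
  assumes "j < l" "k < l" "j \<noteq> k"
  shows "\<not> cospectral n (joined j) (joined k)"
proof
  let ?p = "\<lambda>k. chain_poly (Suc (Suc k)) - chain_poly (Suc k)"
  let ?q = "\<lambda>k. chain_poly (Suc (Suc k)) + chain_poly (Suc k)"
  let ?t = "char_poly (laplacian n T)"
  let ?g = "char_poly (laplacian n (joined j))"
  assume "cospectral n (joined j) (joined k)"
  then have "?p j * ?g = ?q j * ?t" "?p k * ?g = ?q k * ?t"
    using char_poly_joined assms unfolding cospectral_iff by metis+
  then have eq: "?q j * ?t = ?p j * ?g" "?q k * ?t = ?p k * ?g" by (simp_all only:)
  have "?t * (?q j * ?p k) = (?q j * ?t) * ?p k" by (simp only: mult_ac)
  also have "\<dots> = (?q k * ?t) * ?p j" unfolding eq by (simp only: mult_ac)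
  also have "\<dots> = ?t * (?q k * ?p j)" by (simp only: mult_ac)
  finally have "?t * (?q j * ?p k) = ?t * (?q k * ?p j)" .
  \<comment> \<open>The factor \<open>?t\<close> must be cancelled before evaluating at 0, because
    the Laplacian is singular. What remains reads \<open>2 * j + 3 = 2 * k + 3\<close>.\<close>
  then have "?q j * ?p k = ?q k * ?p j"
    using char_poly_laplacian_nonzero[of n T] mult_left_cancel by blast
  then have "poly (?q j * ?p k) 0 = poly (?q k * ?p j) 0" by simp
  then show False using assms(3) by (simp add: poly_chain_poly_0 del: chain_poly.simps)
qed

section \<open>The unique cycle of a joined graph\<close>

lemma unicyclic_joined:
  assumes k: "k < l"
  shows "unicyclic n (joined k)"
  unfolding joined_def
proof (rule unicyclic_insert)
  \<comment> \<open>The walk starts at the hub, runs out along the odd labels at positions 1 to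
    \<open>Suc k\<close>, and comes back along the even labels at the remaining positions.\<close>
  define c where "c i = (if i = 0 then 0 else if i \<le> Suc k then block k + 1 + 2 * (i - 1)
    else block k + 2 + 2 * (2 * k + 2 - i))" for i
  define us where "us = map c [0..<2 * k + 3]"
  let ?a = "block (Suc k) - 1" and ?b = "block (Suc k)"
  have c0: "c 0 = 0" by (simp add: c_def)
  have c1: "c (Suc t) = block k + 1 + 2 * t" if "t \<le> k" for t using that by (simp add: c_def)
  have c2: "c (2 * k + 2 - t) = block k + 2 + 2 * t" if "t \<le> k" for t
    using that by (simp add: c_def)
  have len: "length us = 2 * k + 3" by (simp add: us_def)
  have nth: "us ! i = c i" if "i < 2 * k + 3" for i using that by (simp add: us_def)
  let ?N = "2 * k + 3"
  \<comment> \<open>Three kinds of steps: outwards along the odd path, across the new edge, and back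
    along the even path. The parameter \<open>t\<close> is the coordinate of the child of the edge
    used.\<close>
  have index: "(\<exists>t\<le>k. i = t) \<or> i = Suc k \<or> (\<exists>t\<le>k. i = 2 * k + 2 - t)" if "i < ?N" for i
  proof (cases "i \<le> Suc k")
    case False
    with that have "i = 2 * k + 2 - (2 * k + 2 - i)" "2 * k + 2 - i \<le> k" by auto
    then show ?thesis by blast
  qed auto
  have set_us: "set us = insert 0 {block k<..block (Suc k)}"
  proof (intro equalityI subsetI)
    fix v assume "v \<in> set us"
    then obtain i where "i < 2 * k + 3" "v = c i" by (auto simp: us_def)
    then show "v \<in> insert 0 {block k<..block (Suc k)}"
      using index[of i] by (auto simp: block_Suc c_def)
  next
    fix v assume v: "v \<in> insert 0 {block k<..block (Suc k)}"
    have mem: "c i \<in> set us" if "i < 2 * k + 3" for i using that by (simp add: us_def)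
    show "v \<in> set us"
    proof (cases "v = 0")
      case False
      with v obtain t e where te: "t \<le> k" "e = 1 \<or> e = 2" "v = block k + e + 2 * t"
        using block_vertex_cases[of k v] by auto
      then show ?thesis
        using mem[of "Suc t"] mem[of "2 * k + 2 - t"] c1[of t] c2[of t] by auto
    qed (use mem[of 0] c0 in simp)
  qed
  \<comment> \<open>The list has as many entries as its set has elements, hence no
    repetition.\<close>
  have "card (insert 0 {block k<..block (Suc k)}) = 2 * k + 3"
    by (simp add: block_Suc)
  then show distinct: "distinct us" using set_us len by (metis card_distinct)
  show "3 \<le> length us" by (simp add: len)
  have edges: "e \<in> cycle_edges us \<longleftrightarrow> (\<exists>i<2 * k + 3. e = {c i, c (Suc i mod (2 * k + 3))})" for e
  proof -
    have "{us ! i, us ! (Suc i mod ?N)} = {c i, c (Suc i mod ?N)}" if "i < ?N" for i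
      using that nth by simp
    then show ?thesis unfolding cycle_edges_def len mem_Collect_eq by (intro ex_cong1) auto
  qed
  have odd_edge: "{c t, c (Suc t mod ?N)} = {block k + 1 + 2 * t, par (block k + 1 + 2 * t)}"
    if "t \<le> k" for t
    using par_vertex[OF k that, of 1] that c0 c1[OF that] c1[of "t - 1"] by (cases t) auto
  have even_edge: "{c (2 * k + 2 - t), c (Suc (2 * k + 2 - t) mod ?N)} =
      {block k + 2 + 2 * t, par (block k + 2 + 2 * t)}" if "t \<le> k" for t
  proof (cases t)
    case (Suc t')
    then have "Suc (2 * k + 2 - t) mod ?N = 2 * k + 2 - t'" using that by simp
    then show ?thesis using par_vertex[OF k that, of 2] c2[OF that] c2[of t'] Suc that by auto
  next
    case 0
    \<comment> \<open>The last step of the walk wraps around to the hub.\<close>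
    then have "Suc (2 * k + 2 - t) = ?N" by simp
    then have "Suc (2 * k + 2 - t) mod ?N = 0" by (simp only: mod_self)
    then show ?thesis using 0 par_vertex[OF k that, of 2] c2[OF that] c0 by auto
  qed
  have new_edge: "{c (Suc k), c (Suc (Suc k) mod ?N)} = {?a, ?b}"
    using c1[of k] c2[of k] by (auto simp: block_Suc)
  have tree_edge: "{v, par v} \<in> T" if "block k < v" "v \<le> block (Suc k)" for v
    using that block_less[OF k] by (auto simp: parent_tree_def)
  have edge: "{c i, c (Suc i mod ?N)} \<in> insert {?a, ?b} T" if "i < ?N" for i
    using index[OF that] odd_edge even_edge new_edge tree_edge
    by (elim disjE exE conjE) (auto simp: block_Suc)
  show "cycle_edges us \<subseteq> insert {?a, ?b} T"
  proof
    fix e assume "e \<in> cycle_edges us"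
    then obtain i where i: "i < ?N" "e = {c i, c (Suc i mod ?N)}" unfolding edges by blast
    show "e \<in> insert {?a, ?b} T" unfolding i(2) by (rule edge[OF i(1)])
  qed
  show "?a < n" "?b < n" "?a \<noteq> ?b" using block_less[OF k] by (auto simp: block_Suc)
  show "?a \<in> set us" "?b \<in> set us" by (auto simp: set_us block_Suc)
  show "par v \<in> set us" if "v \<in> set us" "1 \<le> v" for v
    using par_in_block[OF k, of v] that by (auto simp: set_us)
  show "e \<in> cycle_edges us" if "e \<in> insert {?a, ?b} T" "e \<subseteq> set us" for e
  proof (cases "e = {?a, ?b}")
    case True
    then have "e = {c (Suc k), c (Suc (Suc k) mod ?N)}" by (simp only: new_edge)
    moreover have "Suc k < ?N" by simp
    ultimately show ?thesis by (intro iffD2[OF edges] exI[of _ "Suc k"] conjI)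
  next
    case False
    with that(1) have "e \<in> T" by (simp only: insert_iff simp_thms)
    then obtain v where "v \<in> {1..<n}" and v: "e = {v, par v}"
      unfolding parent_tree_def by (rule imageE)
    then have "block k < v" "v \<le> block (Suc k)"
      using that(2) by (simp_all add: set_us)
    then obtain t e' where te: "t \<le> k" "e' = 1 \<or> e' = 2" "v = block k + e' + 2 * t"
      by (rule block_vertex_cases)
    from te(2) show ?thesis
    proof
      assume "e' = 1"
      with te v have "e = {c t, c (Suc t mod ?N)}" using odd_edge[OF te(1)] by simp
      moreover have "t < ?N" using te(1) by simp
      ultimately show ?thesis by (intro iffD2[OF edges] exI[of _ t] conjI)
    next
      assume "e' = 2"
      with te v have "e = {c (2 * k + 2 - t), c (Suc (2 * k + 2 - t) mod ?N)}"
        using even_edge[OF te(1)] by simp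
      moreover have "2 * k + 2 - t < ?N" by simp
      ultimately show ?thesis by (intro iffD2[OF edges] exI[of _ "2 * k + 2 - t"] conjI)
    qed
  qed
qed

lemma equienergetic_family_joined: "equienergetic_unicyclic_family l n (joined ` {..<l})"
proof -
  \<comment> \<open>Non-cospectral graphs are different, so the family really has \<open>l\<close>
    members.\<close>
  have "inj_on joined {..<l}"
  proof (rule inj_onI, rule ccontr)
    fix j k assume "j \<in> {..<l}" "k \<in> {..<l}" "joined j = joined k" "j \<noteq> k"
    then show False using not_cospectral_joined[of j k] by (simp add: cospectral_def)
  qed
  moreover have "pairwise (\<lambda>E E'. \<not> cospectral n E E') (joined ` {..<l})"
    by (rule pairwiseI) (use not_cospectral_joined in auto)
  ultimately show ?thesis
    by (simp add: equienergetic_unicyclic_family_def card_image unicyclic_joined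
        laplacian_energy_joined)
qed

section \<open>Degrees, and two explicit families\<close>

lemma outgoing_joined_0:
  assumes "k < l"
  shows "outgoing (joined k) 0 = {j. 1 \<le> j \<and> j < n \<and> par j = 0}"
proof -
  have "outgoing (joined k) 0 = outgoing T 0"
    by (auto simp: outgoing_def joined_def block_Suc doubleton_eq_iff)
  then show ?thesis using n_pos by (simp add: outgoing_tree)
qed

text \<open>The joined ends have consecutive labels, which gives a bound uniform in
  \<open>k\<close>.\<close>

lemma outgoing_joined_subset:
  assumes "v < n" "v \<noteq> 0"
  shows "outgoing (joined k) v \<subseteq> {par v, v - 1, v + 1} \<union> {j. 1 \<le> j \<and> j < n \<and> par j = v}"
proof -
  have "outgoing (joined k) v \<subseteq> outgoing T v \<union> {v - 1, v + 1}"
    by (auto simp: outgoing_def joined_def block_Suc doubleton_eq_iff)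
  then show ?thesis using assms by (auto simp: outgoing_tree)
qed

end

text \<open>The vertices above the blocks become leaves at the hub, except that \<open>t\<close> is
  moved onto its predecessor; \<open>t = 0\<close> means no exception.\<close>

definition spider_parent :: "nat \<Rightarrow> nat \<Rightarrow> nat \<Rightarrow> nat" where
  "spider_parent l t v =
    (if block l < v then if v = t then v - 1 else 0
     else if \<exists>k. v = block k + 1 \<or> v = block k + 2 then 0 else v - 2)"

text \<open>The strict bound on \<open>t\<close> ensures that its parent \<open>t - 1\<close> also
  lies above the blocks.\<close>

lemma paired_paths_spider:
  assumes "block l < n" "t = 0 \<or> Suc (block l) < t"
  shows "paired_paths n (spider_parent l t) l"
proof
  show "0 < n" using assms by simp
  show "spider_parent l t v < v" if "1 \<le> v" "v < n" for v
    using that by (auto simp: spider_parent_def)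
  fix k assume k: "k < l"
  then have "block (Suc k) \<le> block l" by (intro block_mono) simp
  then show "spider_parent l t (block k + 1) = 0" "spider_parent l t (block k + 2) = 0"
    by (auto simp: spider_parent_def block_Suc)
  show "spider_parent l t v = v - 2" if v: "block k + 2 < v" "v \<le> block (Suc k)" for v
  proof -
    have "v \<noteq> block j + 1 \<and> v \<noteq> block j + 2" for j
      using block_mono[of j k] block_mono[of "Suc k" j] v by (cases "j \<le> k") auto
    then show ?thesis using v \<open>block (Suc k) \<le> block l\<close> by (auto simp: spider_parent_def)
  qed
next
  show "spider_parent l t v = 0 \<or> block l < spider_parent l t v" if "block l < v" "v < n" for v
    using that assms(2) by (auto simp: spider_parent_def)
qed (use assms in simp)

text \<open>The hub of the first family has larger degree than every vertex of the second.\<close>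

lemma not_same_family:
  assumes l: "0 < l" and n: "block l + 6 \<le> n"
  shows "\<not> same_family n (paired_paths.joined n (spider_parent l 0) ` {..<l})
    (paired_paths.joined n (spider_parent l (n - 1)) ` {..<l})"
proof
  interpret P: paired_paths n "spider_parent l 0" l
    using n by (intro paired_paths_spider) auto
  interpret Q: paired_paths n "spider_parent l (n - 1)" l
    using n by (intro paired_paths_spider) auto
  let ?P = "{j. 1 \<le> j \<and> j < n \<and> spider_parent l 0 j = 0}"
  let ?Q = "{j. 1 \<le> j \<and> j < n \<and> spider_parent l (n - 1) j = 0}"
  have fin: "finite ?P" by (rule finite_subset[of _ "{..<n}"]) auto
  assume "same_family n (P.joined ` {..<l}) (Q.joined ` {..<l})"
  then have "\<forall>E\<in>P.joined ` {..<l}. \<exists>E'\<in>Q.joined ` {..<l}. graph_iso n E E'"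
    unfolding same_family_def by (rule conjunct1)
  moreover have "P.joined 0 \<in> P.joined ` {..<l}" using l by simp
  ultimately have "\<exists>E'\<in>Q.joined ` {..<l}. graph_iso n (P.joined 0) E'" by (rule bspec)
  then obtain k where k: "k < l" and "graph_iso n (P.joined 0) (Q.joined k)" by auto
  then obtain f where f: "bij_betw f {..<n} {..<n}" "(`) f ` P.joined 0 = Q.joined k"
    unfolding graph_iso_def by (elim exE conjE)
  have "degree_in (P.joined 0) 0 \<le> degree_in (Q.joined k) (f 0)"
    by (rule graph_iso_degree_in_le[OF P.simple_graph_joined[OF l] Q.finite_joined f P.n_pos])
  then have le: "card ?P \<le> card (outgoing (Q.joined k) (f 0))"
    by (simp only: degree_in_eq_card_outgoing[OF P.simple_graph_joined[OF l]]
        degree_in_eq_card_outgoing[OF Q.simple_graph_joined[OF k]] P.outgoing_joined_0[OF l])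
  have f0: "f 0 < n" using f(1) P.n_pos by (auto simp: bij_betw_def)
  \<comment> \<open>In the first family all vertices above the blocks hang on the hub, and there are
    at least five.\<close>
  have "{block l<..<n} \<subseteq> ?P" by (auto simp: spider_parent_def)
  from card_mono[OF fin this] have large: "5 \<le> card ?P" using n by simp
  show False
  proof (cases "f 0 = 0")
    case True
    \<comment> \<open>If the hub is mapped to the hub, the degrees differ because
      \<open>n - 1\<close> hangs on it only in the first family.\<close>
    have leaf: "n - 1 \<in> ?P" "n - 1 \<notin> ?Q" using n by (simp_all add: spider_parent_def)
    have "spider_parent l 0 j = 0" if "spider_parent l (n - 1) j = 0" for j
    proof (cases "j = n - 1")
      case False
      then show ?thesis using that by (simp add: spider_parent_def split del: if_split cong: if_cong)
    next
      case True
      then show ?thesis using leaf that unfolding mem_Collect_eq by blast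
    qed
    then have "?Q \<subseteq> ?P" by (intro Collect_mono impI conjI) simp_all
    with leaf have "?Q \<subset> ?P" by (simp only: psubset_eq) metis
    then have "card ?Q < card ?P" by (rule psubset_card_mono[OF fin])
    then show False using le Q.outgoing_joined_0[OF k] True by simp
  next
    case False
    let ?v = "f 0"
    \<comment> \<open>A child is two labels up on a path, or it is the moved vertex, one label up.
      With the parent and a possible new edge this leaves at most four neighbours.\<close>
    have "j = ?v + 1 \<or> j = ?v + 2" if "1 \<le> j" "spider_parent l (n - 1) j = ?v" for j
      using that False unfolding spider_parent_def by (simp split: if_splits) linarith+
    then have "{j. 1 \<le> j \<and> j < n \<and> spider_parent l (n - 1) j = ?v} \<subseteq> {?v + 1, ?v + 2}" by simp blast
    then have "outgoing (Q.joined k) ?v \<subseteq> {spider_parent l (n - 1) ?v, ?v - 1, ?v + 1, ?v + 2}"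
      using Q.outgoing_joined_subset[OF f0 False, of k] by blast
    then have "card (outgoing (Q.joined k) ?v) \<le> card {spider_parent l (n - 1) ?v, ?v - 1, ?v + 1, ?v + 2}"
      by (intro card_mono) auto
    also have "\<dots> \<le> 4" by (simp add: card_insert_if)
    finally show False using le large by simp
  qed
qed

theorem theorem3p3:
  fixes l \<gamma> :: nat
  assumes "l \<ge> 2" and "\<gamma> \<ge> 1"
  shows "(\<exists>F. equienergetic_unicyclic_family l (2 * l^2 + 2 * l + 2 * \<gamma>) F) \<and>
    (\<gamma> \<ge> 2 \<longrightarrow>
      (\<exists>F F'. equienergetic_unicyclic_family l (2 * l^2 + 2 * l + 2 * \<gamma>) F \<and>
              equienergetic_unicyclic_family l (2 * l^2 + 2 * l + 2 * \<gamma>) F' \<and>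
              \<not> same_family (2 * l^2 + 2 * l + 2 * \<gamma>) F F'))"
proof -
  define n where "n = 2 * l^2 + 2 * l + 2 * \<gamma>"
  \<comment> \<open>The difference of \<open>n\<close> and \<open>block l\<close> is
    \<open>l * l + l + 2 * \<gamma>\<close>, which is thus at least 8.\<close>
  have "2 * 2 \<le> l * l" using assms(1) by (intro mult_le_mono)
  then have n: "block l + 6 \<le> n"
    using assms by (simp add: n_def block_def power2_eq_square)
  have family: "equienergetic_unicyclic_family l n (paired_paths.joined n (spider_parent l t) ` {..<l})"
    if "t = 0 \<or> t = n - 1" for t
    using n that by (intro paired_paths.equienergetic_family_joined paired_paths_spider) auto
  have "\<not> same_family n (paired_paths.joined n (spider_parent l 0) ` {..<l})
      (paired_paths.joined n (spider_parent l (n - 1)) ` {..<l})"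
    using n assms(1) by (intro not_same_family) auto
  then show ?thesis using family unfolding n_def[symmetric] by blast
qed

end
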